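(* Let $\mathcal{M}$ be a class of matroids closed under taking contractions. Suppose that for some natural number $s$ and positive constants $c$ and $\epsilon$ we have, for all $n$, $$\max\{\kappa(M) : M \in \mathcal{M}\cap\mathbb{M}_{n,s}\} \le c\, n^{s-1-\epsilon}.$$ Then $$\log_2|\mathcal{M}\cap\mathbb{M}_n| \le O\!\left(\frac{1}{n^{3/2+\epsilon}}2^n\log^2(n)\right) \quad \text{as } n\to\infty.$$
   Context: $\mathbb{M}_n$ is the set of matroids with ground set $[n]=\{1,\dots,n\}$ and $\mathbb{M}_{n,r}$ the set of those of rank $r$; classes of matroids are closed under isomorphism. A non-basis of a matroid $M$ is a set of size $r(M)$ that is not a basis. A flat $F$ covers a set $X$ if $|X\cap F|>r_M(F)$. A flat cover of $M$ is a set of flats of $M$ such that every non-basis is covered by some member. The cover complexity $\kappa(M)$ is the minimum size of a flat cover of $M$. *)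

theory Defs
  imports Complex_Main "HOL-Library.Landau_Symbols"
begin

record 'a matroid =
  ground :: "'a set"
  indep :: "'a set set"

definition is_matroid :: "'a matroid \<Rightarrow> bool" where
  "is_matroid M \<longleftrightarrow>
     finite (ground M) \<and>
     indep M \<subseteq> Pow (ground M) \<and>
     {} \<in> indep M \<and>
     (\<forall>I J. J \<in> indep M \<and> I \<subseteq> J \<longrightarrow> I \<in> indep M) \<and>
     (\<forall>I J. I \<in> indep M \<and> J \<in> indep M \<and> card I < card J \<longrightarrow>
        (\<exists>e \<in> J - I. insert e I \<in> indep M))"

definition basis :: "'a matroid \<Rightarrow> 'a set \<Rightarrow> bool" where
  "basis M B \<longleftrightarrow> B \<in> indep M \<and> (\<forall>I \<in> indep M. B \<subseteq> I \<longrightarrow> I = B)"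

definition rank_of :: "'a matroid \<Rightarrow> 'a set \<Rightarrow> nat" where
  "rank_of M X = Max (card ` {I \<in> indep M. I \<subseteq> X})"

abbreviation rank :: "'a matroid \<Rightarrow> nat" where
  "rank M \<equiv> rank_of M (ground M)"

definition non_basis :: "'a matroid \<Rightarrow> 'a set \<Rightarrow> bool" where
  "non_basis M X \<longleftrightarrow> X \<subseteq> ground M \<and> card X = rank M \<and> \<not> basis M X"

definition flat :: "'a matroid \<Rightarrow> 'a set \<Rightarrow> bool" where
  "flat M F \<longleftrightarrow> F \<subseteq> ground M \<and>
     (\<forall>e \<in> ground M - F. rank_of M F < rank_of M (insert e F))"

definition covers :: "'a matroid \<Rightarrow> 'a set \<Rightarrow> 'a set \<Rightarrow> bool" where
  "covers M F X \<longleftrightarrow> card (X \<inter> F) > rank_of M F"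

definition flat_cover :: "'a matroid \<Rightarrow> 'a set set \<Rightarrow> bool" where
  "flat_cover M \<F> \<longleftrightarrow> (\<forall>F \<in> \<F>. flat M F) \<and>
     (\<forall>X. non_basis M X \<longrightarrow> (\<exists>F \<in> \<F>. covers M F X))"

text \<open>The minimum is over a finite nonempty set: the flats spanned by the non-bases form a
  flat cover.\<close>

definition cover_complexity :: "'a matroid \<Rightarrow> nat" where
  "cover_complexity M = Min (card ` {\<F>. flat_cover M \<F>})"

text \<open>The independence condition says that \<open>I\<close> has full rank in the contraction, whose rank
  function is \<open>r(I \<union> X) - r(X)\<close>; it is stated additively to avoid truncated subtraction.\<close>

definition contract :: "'a matroid \<Rightarrow> 'a set \<Rightarrow> 'a matroid" where
  "contract M X =
     \<lparr>ground = ground M - X,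
      indep = {I. I \<subseteq> ground M - X \<and> rank_of M (I \<union> X) = rank_of M X + card I}\<rparr>"

definition isomorphic :: "'a matroid \<Rightarrow> 'b matroid \<Rightarrow> bool" where
  "isomorphic M N \<longleftrightarrow> (\<exists>f. bij_betw f (ground M) (ground N) \<and>
     (\<forall>I. I \<subseteq> ground M \<longrightarrow> (I \<in> indep M \<longleftrightarrow> f ` I \<in> indep N)))"

text \<open>Ground sets are finite sets of natural numbers, which up to isomorphism loses no finite
  matroid.\<close>

definition matroid_class :: "nat matroid set \<Rightarrow> bool" where
  "matroid_class \<M> \<longleftrightarrow> (\<forall>M \<in> \<M>. is_matroid M) \<and>
     (\<forall>M \<in> \<M>. \<forall>N. is_matroid N \<and> isomorphic M N \<longrightarrow> N \<in> \<M>)"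

definition contraction_closed :: "'a matroid set \<Rightarrow> bool" where
  "contraction_closed \<M> \<longleftrightarrow> (\<forall>M \<in> \<M>. \<forall>X. X \<subseteq> ground M \<longrightarrow> contract M X \<in> \<M>)"

definition matroids_on :: "nat \<Rightarrow> nat matroid set" where
  "matroids_on n = {M. is_matroid M \<and> ground M = {1..n}}"

definition matroids_on_rank :: "nat \<Rightarrow> nat \<Rightarrow> nat matroid set" where
  "matroids_on_rank n r = {M \<in> matroids_on n. rank M = r}"

end

theory Submission
  imports Defs "HOL-Real_Asymp.Real_Asymp"
begin

text \<open>Fix \<open>M\<close> of rank \<open>r\<close> between \<open>n/4\<close> and \<open>3n/4\<close>. If \<open>T\<close> is an independent \<open>(r-s)\<close>-subset of
  a non-basis \<open>X\<close>, then \<open>X - T\<close> is a non-basis of \<open>M/T\<close>, so a flat cover of \<open>M/T\<close>, whose size is at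
  most \<open>c n^(s-1-\<epsilon>)\<close>, takes care of all non-bases containing \<open>T\<close>. A greedily chosen
  family of \<open>O(2^n n^(-1/2-s) log n)\<close> sets \<open>T\<close> misses only a fraction \<open>1/(r choose s)\<close> of the
  \<open>r\<close>-sets, in that they contain no member of the family, and each exceptional non-basis gets a flat of its own. Hence
  \<open>\<kappa>(M) = O(2^n n^(-3/2-\<epsilon>) log n)\<close>. Since \<open>M\<close> is determined by its rank and the ranked flats of a
  flat cover, counting the small subsets of a set of size \<open>2^n (n+1)\<close> costs one more factor
  \<open>log n\<close>. For the remaining \<open>r\<close>, already \<open>n choose r\<close> is exponentially smaller than \<open>2^n\<close>.\<close>

section \<open>Matroids, contractions and flat covers\<close>

context
  fixes M :: "'a matroid"
  assumes matroid: "is_matroid M"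
begin

lemma finite_ground: "finite (ground M)"
  using matroid by (simp add: is_matroid_def)

lemma indep_subset_ground: "I \<in> indep M \<Longrightarrow> I \<subseteq> ground M"
  using matroid by (auto simp: is_matroid_def)

lemma empty_indep: "{} \<in> indep M"
  using matroid by (simp add: is_matroid_def)

lemma indep_mono: "J \<in> indep M \<Longrightarrow> I \<subseteq> J \<Longrightarrow> I \<in> indep M"
  using matroid unfolding is_matroid_def by blast

lemma indep_augment:
  "I \<in> indep M \<Longrightarrow> J \<in> indep M \<Longrightarrow> card I < card J \<Longrightarrow> \<exists>e \<in> J - I. insert e I \<in> indep M"
  using matroid unfolding is_matroid_def by blast

lemma finite_indep_set: "finite (indep M)"
  by (rule finite_subset[of _ "Pow (ground M)"]) (auto simp: finite_ground dest: indep_subset_ground)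

lemma finite_indep: "I \<in> indep M \<Longrightarrow> finite I"
  using indep_subset_ground finite_ground finite_subset by blast

lemma card_le_rank_of: "I \<in> indep M \<Longrightarrow> I \<subseteq> X \<Longrightarrow> card I \<le> rank_of M X"
  unfolding rank_of_def by (rule Max_ge) (auto simp: finite_indep_set)

lemma rank_of_attained: "\<exists>I \<in> indep M. I \<subseteq> X \<and> card I = rank_of M X"
proof -
  have "rank_of M X \<in> card ` {I \<in> indep M. I \<subseteq> X}"
    unfolding rank_of_def by (rule Max_in) (use finite_indep_set empty_indep in auto)
  thus ?thesis by auto
qed

text \<open>Induction on the deficiency \<open>rank_of M X - card J\<close>: augmenting from a
  maximum independent subset of \<open>X\<close> never leaves \<open>X\<close>.\<close>

lemma extend_indep:
  assumes "J \<in> indep M" "J \<subseteq> X"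
  shows "\<exists>I \<in> indep M. J \<subseteq> I \<and> I \<subseteq> X \<and> card I = rank_of M X"
  using assms
proof (induction "rank_of M X - card J" arbitrary: J rule: less_induct)
  case less
  show ?case
  proof (cases "card J = rank_of M X")
    case True
    then show ?thesis using less.prems by blast
  next
    case False
    obtain I where I: "I \<in> indep M" "I \<subseteq> X" "card I = rank_of M X"
      using rank_of_attained by blast
    have "card J \<le> rank_of M X"
      using less.prems by (rule card_le_rank_of)
    with False have lt: "card J < rank_of M X" by simp
    then obtain e where e: "e \<in> I - J" "insert e J \<in> indep M"
      using indep_augment[OF less.prems(1) I(1)] I(3) by auto
    have "card (insert e J) = Suc (card J)"
      using e finite_indep[OF less.prems(1)] by simp
    then have "rank_of M X - card (insert e J) < rank_of M X - card J"
      using lt by simp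
    from less.hyps[OF this e(2)] show ?thesis
      using e(1) I(2) less.prems(2) by blast
  qed
qed

lemma rank_of_le_card: "finite X \<Longrightarrow> rank_of M X \<le> card X"
  using rank_of_attained[of X] by (metis card_mono)

lemma rank_of_indep: "I \<in> indep M \<Longrightarrow> rank_of M I = card I"
  using card_le_rank_of[of I I] rank_of_le_card[of I] finite_indep by auto

lemma indep_if_rank_of_eq_card: "finite X \<Longrightarrow> rank_of M X = card X \<Longrightarrow> X \<in> indep M"
  using rank_of_attained[of X] by (metis card_subset_eq)

lemma rank_of_mono: "X \<subseteq> Y \<Longrightarrow> rank_of M X \<le> rank_of M Y"
  by (metis rank_of_attained card_le_rank_of subset_trans)

lemma basis_iff: "basis M B \<longleftrightarrow> B \<in> indep M \<and> card B = rank M"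
proof
  assume B: "basis M B"
  then have "B \<in> indep M" by (simp add: basis_def)
  moreover from this obtain I where "I \<in> indep M" "B \<subseteq> I" "card I = rank M"
    using extend_indep indep_subset_ground by blast
  ultimately show "B \<in> indep M \<and> card B = rank M"
    using B by (auto simp: basis_def)
next
  assume B: "B \<in> indep M \<and> card B = rank M"
  show "basis M B"
    unfolding basis_def
  proof (intro conjI ballI impI)
    fix I assume I: "I \<in> indep M" "B \<subseteq> I"
    then have "card I \<le> card B"
      using B card_le_rank_of indep_subset_ground by metis
    with I show "I = B"
      using card_seteq finite_indep by blast
  qed (use B in simp)
qed

lemma non_basis_iff:
  "non_basis M X \<longleftrightarrow> X \<subseteq> ground M \<and> card X = rank M \<and> X \<notin> indep M"
  by (auto simp: non_basis_def basis_iff)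

text \<open>The right-hand side depends on \<open>M\<close> only through its ground set, rank and
  non-bases, so these data determine the matroid.\<close>

lemma indep_iff_subset_basis:
  "I \<in> indep M \<longleftrightarrow> (\<exists>B. B \<subseteq> ground M \<and> card B = rank M \<and> \<not> non_basis M B \<and> I \<subseteq> B)"
  using extend_indep[of I "ground M"] indep_subset_ground[of I] indep_mono
  by (auto simp: non_basis_iff)

section \<open>Flats and flat covers\<close>

lemma flat_spanned:
  assumes "X \<subseteq> ground M"
  shows "\<exists>F. flat M F \<and> X \<subseteq> F \<and> rank_of M F = rank_of M X"
proof -
  \<comment> \<open>An inclusion-maximal superset of the same rank plays the role of the closure of
    \<open>X\<close>: any further element must raise the rank.\<close>
  define S where "S = {F. X \<subseteq> F \<and> F \<subseteq> ground M \<and> rank_of M F = rank_of M X}"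
  have "finite S"
    by (rule finite_subset[of _ "Pow (ground M)"]) (auto simp: S_def finite_ground)
  moreover have "X \<in> S" using assms by (simp add: S_def)
  ultimately obtain F where F: "F \<in> S" and max: "\<And>G. G \<in> S \<Longrightarrow> F \<subseteq> G \<Longrightarrow> G = F"
    using finite_has_maximal[of S] by (metis empty_iff)
  have "rank_of M F < rank_of M (insert e F)" if e: "e \<in> ground M - F" for e
  proof -
    have "insert e F \<notin> S" using max[of "insert e F"] e by blast
    then have "rank_of M (insert e F) \<noteq> rank_of M F"
      using F e by (auto simp: S_def)
    moreover have "rank_of M F \<le> rank_of M (insert e F)"
      by (rule rank_of_mono) auto
    ultimately show ?thesis by linarith
  qed
  then have "flat M F" using F unfolding flat_def S_def by blast
  then show ?thesis using F unfolding S_def by blast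
qed

text \<open>The flat spanned by \<open>X\<close> contains \<open>X\<close> but has rank below
  \<open>card X\<close>, so it serves all finite supersets at once. This is how a single flat
  disposes of a dependent \<open>T\<close>.\<close>

lemma dependent_covered:
  assumes "X \<subseteq> ground M" "X \<notin> indep M"
  shows "\<exists>F. flat M F \<and> (\<forall>Y. X \<subseteq> Y \<longrightarrow> finite Y \<longrightarrow> covers M F Y)"
proof -
  obtain F where F: "flat M F" "X \<subseteq> F" "rank_of M F = rank_of M X"
    using flat_spanned[OF assms(1)] by blast
  have "finite X" using assms(1) finite_ground finite_subset by blast
  then have lt: "rank_of M X < card X"
    using rank_of_le_card indep_if_rank_of_eq_card assms(2) by (metis le_neq_implies_less)
  have "covers M F Y" if "X \<subseteq> Y" "finite Y" for Y
  proof -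
    have "card X \<le> card (Y \<inter> F)"
      using that F(2) by (intro card_mono) auto
    then show ?thesis using lt F(3) by (simp add: covers_def)
  qed
  with F(1) show ?thesis by blast
qed

text \<open>Otherwise \<open>X \<inter> F\<close> would be an independent subset of \<open>F\<close>
  larger than its rank. Hence, among the sets of size \<open>rank M\<close>, a flat cover detects
  exactly the non-bases.\<close>

lemma not_indep_if_covers:
  assumes "flat M F" "covers M F X"
  shows "X \<notin> indep M"
proof
  assume "X \<in> indep M"
  then have "card (X \<inter> F) \<le> rank_of M F"
    by (intro card_le_rank_of) (auto intro: indep_mono)
  with assms show False by (simp add: covers_def)
qed

lemma flat_cover_bounded: "flat_cover M \<F> \<Longrightarrow> \<F> \<subseteq> Pow (ground M)"
  by (auto simp: flat_cover_def flat_def)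

lemma finite_flat_cover: "flat_cover M \<F> \<Longrightarrow> finite \<F>"
  using flat_cover_bounded finite_ground by (meson finite_Pow_iff finite_subset)

lemma finite_flat_covers: "finite {\<F>. flat_cover M \<F>}"
  by (rule finite_subset[of _ "Pow (Pow (ground M))"])
    (use flat_cover_bounded finite_ground in auto)

text \<open>Guarantees that the minimum in \<open>cover_complexity\<close> is taken over a nonempty
  set.\<close>

lemma flat_cover_all_flats: "flat_cover M {F. flat M F}"
  unfolding flat_cover_def
proof (intro conjI ballI allI impI)
  fix X assume "non_basis M X"
  then have X: "X \<subseteq> ground M" "X \<notin> indep M" by (auto simp: non_basis_iff)
  then show "\<exists>F\<in>{F. flat M F}. covers M F X"
    using dependent_covered[OF X] finite_ground finite_subset by blast
qed auto

lemma cover_complexity_attained: "\<exists>\<F>. flat_cover M \<F> \<and> card \<F> = cover_complexity M"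
proof -
  have "cover_complexity M \<in> card ` {\<F>. flat_cover M \<F>}"
    unfolding cover_complexity_def
    by (rule Min_in) (use finite_flat_covers flat_cover_all_flats in auto)
  thus ?thesis by auto
qed

lemma no_non_basis_if_cover_complexity_zero:
  assumes "cover_complexity M = 0"
  shows "\<not> non_basis M X"
proof -
  obtain \<F> where "flat_cover M \<F>" "card \<F> = 0"
    using cover_complexity_attained assms by auto
  \<comment> \<open>Finiteness rules out an infinite family, whose \<open>card\<close> would be 0 as
    well.\<close>
  then have "flat_cover M {}" using finite_flat_cover by auto
  then show ?thesis by (auto simp: flat_cover_def)
qed

section \<open>Contraction by an independent set\<close>

context
  fixes T :: "'a set"
  assumes indep_T: "T \<in> indep M"
begin

text \<open>The rank of an independent \<open>T\<close> is its cardinality, so the additive rank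
  condition says that \<open>I \<union> T\<close> has full rank.\<close>

lemma contract_indep:
  "I \<in> indep (contract M T) \<longleftrightarrow> I \<subseteq> ground M - T \<and> I \<union> T \<in> indep M"
proof -
  have "card (I \<union> T) = card I + card T" "finite (I \<union> T)" if "I \<subseteq> ground M - T"
    using that finite_subset[OF _ finite_ground, of I] finite_indep[OF indep_T]
    by (auto intro!: card_Un_disjoint)
  then show ?thesis
    using rank_of_indep[OF indep_T] rank_of_indep[of "I \<union> T"] indep_if_rank_of_eq_card[of "I \<union> T"]
    by (auto simp: contract_def)
qed

text \<open>Adding \<open>T\<close> to an independent set of the contraction gives one inequality;
  extending \<open>T\<close> to a maximum independent subset of \<open>F \<union> T\<close> and
  removing \<open>T\<close> gives the other. That the contraction is a matroid is assumed here; for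
  members of the class it comes from closure under contraction.\<close>

lemma contract_rank_of:
  assumes "F \<subseteq> ground M - T" "is_matroid (contract M T)"
  shows "rank_of (contract M T) F + card T = rank_of M (F \<union> T)"
proof (rule antisym)
  obtain I where I: "I \<in> indep (contract M T)" "I \<subseteq> F" "card I = rank_of (contract M T) F"
    using Submission.rank_of_attained[OF assms(2)] by blast
  then have *: "I \<subseteq> ground M - T" "I \<union> T \<in> indep M" by (auto simp: contract_indep)
  then have "card (I \<union> T) = card I + card T"
    using finite_indep[OF *(2)] by (intro card_Un_disjoint) auto
  moreover have "card (I \<union> T) \<le> rank_of M (F \<union> T)"
    using I *(2) by (intro card_le_rank_of) auto
  ultimately show "rank_of (contract M T) F + card T \<le> rank_of M (F \<union> T)"
    using I by simp
next
  obtain J where J: "J \<in> indep M" "T \<subseteq> J" "J \<subseteq> F \<union> T" "card J = rank_of M (F \<union> T)"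
    using extend_indep[OF indep_T, of "F \<union> T"] by auto
  have eq: "(J - T) \<union> T = J" using J by auto
  have "J - T \<in> indep (contract M T)"
    using J eq assms(1) by (auto simp: contract_indep)
  then have "card (J - T) \<le> rank_of (contract M T) F"
    using J by (intro Submission.card_le_rank_of[OF assms(2)]) auto
  moreover have "card J = card (J - T) + card T"
    using J(2) finite_indep[OF J(1)] by (metis card_Diff_subset card_mono finite_subset le_add_diff_inverse2)
  ultimately show "rank_of M (F \<union> T) \<le> rank_of (contract M T) F + card T"
    using J by simp
qed

lemma ground_contract: "ground (contract M T) = ground M - T"
  by (simp add: contract_def)

lemma rank_contract:
  assumes "is_matroid (contract M T)"
  shows "rank (contract M T) + card T = rank M"
proof -
  have "ground M - T \<union> T = ground M" using indep_subset_ground[OF indep_T] by auto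
  then show ?thesis using contract_rank_of[OF _ assms, of "ground M - T"] by (simp add: ground_contract)
qed

text \<open>All ranks shift by the constant \<open>card T\<close>, so strict increases
  survive.\<close>

lemma flat_contract:
  assumes "is_matroid (contract M T)" "flat (contract M T) F"
  shows "flat M (F \<union> T)"
  unfolding flat_def
proof (intro conjI ballI)
  have F: "F \<subseteq> ground M - T" using assms by (simp add: flat_def ground_contract)
  then show "F \<union> T \<subseteq> ground M" using indep_subset_ground[OF indep_T] by auto
  fix e assume e: "e \<in> ground M - (F \<union> T)"
  then have "rank_of (contract M T) F < rank_of (contract M T) (insert e F)"
    using assms by (auto simp: flat_def ground_contract)
  then show "rank_of M (F \<union> T) < rank_of M (insert e (F \<union> T))"
    using contract_rank_of[OF F assms(1)] contract_rank_of[of "insert e F", OF _ assms(1)] F e by auto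
qed

text \<open>Restoring \<open>T\<close> to both the flat and the set raises the rank and the
  intersection size by the same amount \<open>card T\<close>.\<close>

lemma covers_contract:
  assumes "is_matroid (contract M T)" "flat (contract M T) F" "T \<subseteq> X" "finite X"
    "covers (contract M T) F (X - T)"
  shows "covers M (F \<union> T) X"
proof -
  have F: "F \<subseteq> ground M - T" using assms by (simp add: flat_def ground_contract)
  have "X \<inter> (F \<union> T) = ((X - T) \<inter> F) \<union> T" using F assms(3) by auto
  moreover have "card (((X - T) \<inter> F) \<union> T) = card ((X - T) \<inter> F) + card T"
    using assms(4) finite_indep[OF indep_T] by (intro card_Un_disjoint) auto
  ultimately show ?thesis
    using contract_rank_of[OF F assms(1)] assms(5) by (simp add: covers_def)
qed

lemma non_basis_contract:
  assumes "is_matroid (contract M T)" "X \<subseteq> ground M" "card X = rank M" "X \<notin> indep M" "T \<subseteq> X"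
  shows "non_basis (contract M T) (X - T)"
proof -
  have "X - T \<union> T = X" using assms by auto
  moreover have "card (X - T) + card T = card X"
    using assms finite_subset[OF assms(2) finite_ground]
    by (metis card_Diff_subset card_mono finite_subset le_add_diff_inverse2)
  ultimately show ?thesis
    unfolding Submission.non_basis_iff[OF assms(1)]
    using assms rank_contract[OF assms(1)] by (auto simp: ground_contract contract_indep)
qed

end

text \<open>A dependent \<open>T\<close> is handled by a single flat; an independent one by the flats of a minimum
  flat cover of \<open>M/T\<close>, each enlarged by \<open>T\<close>.\<close>

lemma local_flat_cover:
  assumes T: "T \<subseteq> ground M"
    and contract: "T \<in> indep M \<Longrightarrow> is_matroid (contract M T)"
  shows "\<exists>\<F>. finite \<F> \<and> (\<forall>F\<in>\<F>. flat M F) \<and>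
    card \<F> \<le> (if T \<in> indep M then cover_complexity (contract M T) else 1) \<and>
    (\<forall>X. non_basis M X \<longrightarrow> T \<subseteq> X \<longrightarrow> (\<exists>F\<in>\<F>. covers M F X))"
proof (cases "T \<in> indep M")
  case True
  note matroid' = contract[OF True]
  obtain \<G> where \<G>: "flat_cover (contract M T) \<G>" "card \<G> = cover_complexity (contract M T)"
    using Submission.cover_complexity_attained[OF matroid'] by blast
  have fin: "finite \<G>" using Submission.finite_flat_cover[OF matroid' \<G>(1)] .
  have "\<exists>F\<in>(\<lambda>F. F \<union> T) ` \<G>. covers M F X" if X: "non_basis M X" "T \<subseteq> X" for X
  proof -
    have X': "X \<subseteq> ground M" "card X = rank M" "X \<notin> indep M"
      using X by (auto simp: non_basis_iff)
    have "non_basis (contract M T) (X - T)"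
      by (rule non_basis_contract[OF True matroid' X' X(2)])
    then obtain F where "F \<in> \<G>" "flat (contract M T) F" "covers (contract M T) F (X - T)"
      using \<G>(1) by (auto simp: flat_cover_def)
    then show ?thesis
      using covers_contract[OF True matroid' _ X(2)] finite_subset[OF X'(1) finite_ground] by blast
  qed
  moreover have "\<forall>F\<in>(\<lambda>F. F \<union> T) ` \<G>. flat M F"
    using flat_contract[OF True matroid'] \<G>(1) by (auto simp: flat_cover_def)
  moreover have "card ((\<lambda>F. F \<union> T) ` \<G>) \<le> cover_complexity (contract M T)"
    using card_image_le[OF fin] \<G>(2) by metis
  ultimately show ?thesis using fin True by (intro exI[of _ "(\<lambda>F. F \<union> T) ` \<G>"]) simp
next
  case False
  then obtain F where F: "flat M F" "\<forall>Y. T \<subseteq> Y \<longrightarrow> finite Y \<longrightarrow> covers M F Y"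
    using dependent_covered[OF T] by blast
  then show ?thesis
    using False finite_subset[OF _ finite_ground]
    by (intro exI[of _ "{F}"]) (auto simp: non_basis_iff)
qed

text \<open>From a non-basis of \<open>M\<close> one builds a dependent set of size
  \<open>rank M\<close> that contains an independent \<open>T\<close> of size
  \<open>rank M - s\<close>; removing \<open>T\<close> leaves a non-basis of the
  contraction.\<close>

lemma uniform_if_contractions_uniform:
  assumes "s \<le> rank M"
    and contract: "\<And>T. T \<in> indep M \<Longrightarrow> card T = rank M - s \<Longrightarrow>
      is_matroid (contract M T) \<and> (\<forall>Y. \<not> non_basis (contract M T) Y)"
    and "s \<ge> 1"
  shows "\<not> non_basis M X"
proof
  assume "non_basis M X"
  then have X: "X \<subseteq> ground M" "card X = rank M" "X \<notin> indep M" by (auto simp: non_basis_iff)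
  have finX: "finite X" using X(1) finite_ground finite_subset by blast
  obtain I where I: "I \<in> indep M" "I \<subseteq> X" "card I = rank_of M X"
    using rank_of_attained by blast
  show False
  proof (cases "rank M - s \<le> card I")
    case True
    then obtain T where T: "T \<subseteq> I" "card T = rank M - s"
      using obtain_subset_with_card_n by metis
    then have ind: "T \<in> indep M" using I indep_mono by blast
    with contract T X I non_basis_contract[OF ind, of X] show False by blast
  next
    case False
    \<comment> \<open>Here \<open>I\<close> is too small to contain a suitable \<open>T\<close>, so
      \<open>X\<close> is traded for another dependent set \<open>Y\<close>: \<open>I\<close> grows
      to \<open>T\<close> inside a basis, and an element \<open>e\<close> of \<open>X\<close>
      outside \<open>I\<close> makes \<open>insert e T\<close> dependent.\<close>
    obtain B where B: "B \<in> indep M" "I \<subseteq> B" "card B = rank M"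
      using extend_indep[OF I(1) indep_subset_ground[OF I(1)]] by blast
    obtain T where T: "I \<subseteq> T" "T \<subseteq> B" "card T = rank M - s"
      using exists_subset_between[of I "rank M - s" B] False B finite_indep[OF B(1)] by auto
    have indT: "T \<in> indep M" using T B indep_mono by blast
    have "\<not> X \<subseteq> I" using X(3) I(1) indep_mono by blast
    then obtain e where e: "e \<in> X" "e \<notin> I" by blast
    have dep: "insert e I \<notin> indep M"
    proof
      assume "insert e I \<in> indep M"
      then have "card (insert e I) \<le> rank_of M X" using I e by (intro card_le_rank_of) auto
      then show False using I e finite_indep[OF I(1)] by simp
    qed
    have eT: "e \<notin> T" using dep indT T(1) indep_mono by blast
    have "card (ground M) \<ge> rank M"
      using X finite_ground by (metis card_mono)
    moreover have "finite T" using finite_indep[OF indT] .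
    \<comment> \<open>Since \<open>s \<ge> 1\<close>, the set \<open>T\<close> has at most
      \<open>rank M - 1\<close> elements, which leaves room for \<open>e\<close>.\<close>
    ultimately have "rank M \<le> card (ground M)" "insert e T \<subseteq> ground M"
       "card (insert e T) \<le> rank M"
      using e X indep_subset_ground[OF indT] T eT \<open>s \<ge> 1\<close> \<open>s \<le> rank M\<close> by auto
    then obtain Y where Y: "insert e T \<subseteq> Y" "Y \<subseteq> ground M" "card Y = rank M"
      using exists_subset_between[of "insert e T" "rank M" "ground M"] finite_ground by auto
    have "T \<subseteq> Y" "insert e I \<subseteq> Y" using Y(1) T(1) by auto
    then have "Y \<notin> indep M" using dep indep_mono[of Y "insert e I"] by blast
    then show False
      using non_basis_contract[OF indT _ Y(2,3) _ \<open>T \<subseteq> Y\<close>] contract[OF indT T(3)] by simp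
  qed
qed

end

section \<open>Relabelling the ground set\<close>

definition relabel :: "('a \<Rightarrow> 'b) \<Rightarrow> 'a matroid \<Rightarrow> 'b matroid" where
  "relabel f M = \<lparr>ground = f ` ground M, indep = (`) f ` indep M\<rparr>"

context
  fixes M :: "'a matroid" and f :: "'a \<Rightarrow> 'b"
  assumes matroid: "is_matroid M" and inj: "inj_on f (ground M)"
begin

lemma relabel_indep:
  assumes "X \<subseteq> ground M"
  shows "f ` X \<in> indep (relabel f M) \<longleftrightarrow> X \<in> indep M"
proof -
  have "f ` X = f ` Y \<longleftrightarrow> X = Y" if "Y \<in> indep M" for Y
    using inj_on_image_eq_iff[OF inj assms] indep_subset_ground[OF matroid that] by blast
  then show ?thesis by (auto simp: relabel_def)
qed

lemma relabel_is_matroid: "is_matroid (relabel f M)"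
  unfolding is_matroid_def
proof (intro conjI allI impI)
  show "finite (ground (relabel f M))" using finite_ground[OF matroid] by (simp add: relabel_def)
  show "indep (relabel f M) \<subseteq> Pow (ground (relabel f M))"
    using indep_subset_ground[OF matroid] by (fastforce simp: relabel_def)
  show "{} \<in> indep (relabel f M)"
    using relabel_indep[of "{}"] empty_indep[OF matroid] by simp
next
  fix I J assume "J \<in> indep (relabel f M) \<and> I \<subseteq> J"
  then obtain J' where "J' \<in> indep M" "I \<subseteq> f ` J'" by (auto simp: relabel_def)
  moreover from this obtain I' where "I' \<subseteq> J'" "I = f ` I'" by (meson subset_imageE)
  ultimately show "I \<in> indep (relabel f M)"
    using indep_mono[OF matroid] by (auto simp: relabel_def)
next
  fix I J assume *: "I \<in> indep (relabel f M) \<and> J \<in> indep (relabel f M) \<and> card I < card J"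
  then obtain I' J' where IJ: "I' \<in> indep M" "J' \<in> indep M" "I = f ` I'" "J = f ` J'"
    by (auto simp: relabel_def)
  have sub: "I' \<subseteq> ground M" "J' \<subseteq> ground M" using IJ indep_subset_ground[OF matroid] by auto
  have "card I' < card J'"
    using * IJ card_image[OF inj_on_subset[OF inj]] sub by auto
  then obtain e where e: "e \<in> J' - I'" "insert e I' \<in> indep M"
    using indep_augment[OF matroid IJ(1,2)] by blast
  then have "f e \<notin> I" using IJ sub inj by (auto dest: inj_onD)
  moreover have "insert (f e) I \<in> indep (relabel f M)"
    using relabel_indep[of "insert e I'"] e sub IJ by auto
  ultimately show "\<exists>e\<in>J - I. insert e I \<in> indep (relabel f M)" using e IJ by auto
qed

lemma relabel_isomorphic: "isomorphic M (relabel f M)"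
  unfolding isomorphic_def
  by (intro exI[of _ f] conjI) (use inj relabel_indep in \<open>auto simp: bij_betw_def relabel_def\<close>)

lemma relabel_rank_of:
  assumes X: "X \<subseteq> ground M"
  shows "rank_of (relabel f M) (f ` X) = rank_of M X"
proof (rule antisym)
  obtain I where I: "I \<in> indep (relabel f M)" "I \<subseteq> f ` X" "card I = rank_of (relabel f M) (f ` X)"
    using rank_of_attained[OF relabel_is_matroid] by blast
  then obtain I' where I': "I' \<subseteq> X" "I = f ` I'" by (meson subset_imageE)
  then have "I' \<in> indep M" using relabel_indep[of I'] X I by auto
  then have "card I' \<le> rank_of M X" using card_le_rank_of[OF matroid] I' by blast
  moreover have "card I = card I'"
    using I' X by (metis card_image inj inj_on_subset subset_trans)
  ultimately show "rank_of (relabel f M) (f ` X) \<le> rank_of M X" using I by simp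
next
  obtain I where I: "I \<in> indep M" "I \<subseteq> X" "card I = rank_of M X"
    using rank_of_attained[OF matroid] by blast
  then have "f ` I \<in> indep (relabel f M)" using relabel_indep[of I] X by auto
  then have "card (f ` I) \<le> rank_of (relabel f M) (f ` X)"
    using card_le_rank_of[OF relabel_is_matroid] I by blast
  moreover have "card (f ` I) = card I"
    using I X by (metis card_image inj inj_on_subset subset_trans)
  ultimately show "rank_of M X \<le> rank_of (relabel f M) (f ` X)" using I by simp
qed

lemma relabel_rank: "rank (relabel f M) = rank M"
  using relabel_rank_of[of "ground M"] by (simp add: relabel_def)

lemma relabel_flat:
  assumes X: "X \<subseteq> ground M"
  shows "flat (relabel f M) (f ` X) \<longleftrightarrow> flat M X"
proof -
  have "rank_of (relabel f M) (insert (f e) (f ` X)) = rank_of M (insert e X)" if "e \<in> ground M" for e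
    using relabel_rank_of[of "insert e X"] that X by simp
  moreover have "ground (relabel f M) - f ` X = f ` (ground M - X)"
    using inj_on_image_set_diff[OF inj, of "ground M" X] X by (simp add: relabel_def)
  ultimately show ?thesis
    using X relabel_rank_of[OF X] by (auto simp: flat_def relabel_def)
qed

text \<open>Flats are pulled back to their preimages in the ground set, which preserves rank,
  flatness and the sizes of intersections.\<close>

lemma relabel_flat_cover:
  assumes "flat_cover (relabel f M) \<G>"
  shows "\<exists>\<F>. flat_cover M \<F> \<and> card \<F> \<le> card \<G>"
proof -
  define g where "g = (\<lambda>F. {x \<in> ground M. f x \<in> F})"
  have g: "f ` g F = F" "g F \<subseteq> ground M" "flat M (g F)" if "F \<in> \<G>" for F
  proof -
    show 1: "g F \<subseteq> ground M" by (auto simp: g_def)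
    have fl: "flat (relabel f M) F" using that assms by (auto simp: flat_cover_def)
    then show 2: "f ` g F = F" by (auto simp: g_def flat_def relabel_def)
    show "flat M (g F)" using relabel_flat[OF 1] fl 2 by simp
  qed
  have "\<exists>F\<in>g ` \<G>. covers M F X" if "non_basis M X" for X
  proof -
    from that have X: "X \<subseteq> ground M" "card X = rank M" "X \<notin> indep M"
      by (auto simp: non_basis_iff[OF matroid])
    then have "non_basis (relabel f M) (f ` X)"
      unfolding non_basis_iff[OF relabel_is_matroid]
      using relabel_indep[OF X(1)] relabel_rank card_image[OF inj_on_subset[OF inj X(1)]]
      by (auto simp: relabel_def)
    then obtain F where F: "F \<in> \<G>" "covers (relabel f M) F (f ` X)"
      using assms by (auto simp: flat_cover_def)
    have "f ` X \<inter> F = f ` (X \<inter> g F)"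
      using X(1) by (auto simp: g_def)
    moreover have "card (f ` (X \<inter> g F)) = card (X \<inter> g F)"
      using X(1) by (intro card_image inj_on_subset[OF inj]) auto
    ultimately have "covers M (g F) X"
      using F(2) relabel_rank_of[OF g(2)[OF F(1)]] g(1)[OF F(1)] by (simp add: covers_def)
    with F(1) show ?thesis by blast
  qed
  then have "flat_cover M (g ` \<G>)" using g by (auto simp: flat_cover_def)
  moreover have "card (g ` \<G>) \<le> card \<G>"
    using finite_flat_cover[OF relabel_is_matroid assms] by (rule card_image_le)
  ultimately show ?thesis by blast
qed

text \<open>The bound on cover complexity is assumed only for ground sets \<open>{1..n}\<close>,
  whereas a contraction lives on a remainder of such a set; this inequality transfers the
  bound.\<close>

lemma cover_complexity_le_relabel: "cover_complexity M \<le> cover_complexity (relabel f M)"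
proof -
  obtain \<G> where "flat_cover (relabel f M) \<G>" "card \<G> = cover_complexity (relabel f M)"
    using cover_complexity_attained[OF relabel_is_matroid] by blast
  then obtain \<F> where F: "flat_cover M \<F>" "card \<F> \<le> cover_complexity (relabel f M)"
    using relabel_flat_cover by metis
  moreover have "cover_complexity M \<le> card \<F>"
    unfolding cover_complexity_def
    by (rule Min_le) (use F finite_flat_covers[OF matroid] in auto)
  ultimately show ?thesis by simp
qed

end


section \<open>Encoding a matroid by a flat cover\<close>

lemma matroid_eqI:
  fixes M N :: "'a matroid"
  assumes "is_matroid M" "is_matroid N" "ground M = ground N" "rank M = rank N"
    and "\<And>X. non_basis M X \<longleftrightarrow> non_basis N X"
  shows "M = N"
proof -
  have "indep M = indep N"
    using indep_iff_subset_basis[OF assms(1)] indep_iff_subset_basis[OF assms(2)] assms(3-5)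
    by auto
  then show ?thesis using assms(3) by (intro matroid.equality) auto
qed

lemma inj_on_non_bases: "inj_on (\<lambda>M. {X. non_basis M X}) (matroids_on_rank n r)"
proof (rule inj_onI)
  fix M N assume *: "M \<in> matroids_on_rank n r" "N \<in> matroids_on_rank n r"
    "{X. non_basis M X} = {X. non_basis N X}"
  show "M = N"
    by (rule matroid_eqI) (use * in \<open>auto simp: matroids_on_rank_def matroids_on_def set_eq_iff\<close>)
qed

lemma non_bases_in_Pow:
  "(\<lambda>M. {X. non_basis M X}) ` matroids_on_rank n r \<subseteq> Pow {X. X \<subseteq> {1..n} \<and> card X = r}"
  by (auto simp: matroids_on_rank_def matroids_on_def non_basis_def)

lemma finite_matroids_on_rank: "finite (matroids_on_rank n r)"
  by (rule inj_on_finite[OF inj_on_non_bases non_bases_in_Pow]) simp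

text \<open>Coding a matroid by its non-bases is good enough for ranks far from \<open>n/2\<close>,
  where the binomial coefficient is small.\<close>

lemma card_matroids_on_rank_le: "card (matroids_on_rank n r) \<le> 2 ^ (n choose r)"
proof -
  have "card (matroids_on_rank n r) \<le> card (Pow {X. X \<subseteq> {1..n} \<and> card X = r})"
    by (rule card_inj_on_le[OF inj_on_non_bases non_bases_in_Pow]) simp
  also have "\<dots> = 2 ^ (n choose r)" by (simp add: card_Pow n_subsets)
  finally show ?thesis .
qed

text \<open>Exponential weights: every counted set has weight \<open>x ^ card S\<close> at least
  \<open>x powr K\<close>, and the total weight of all subsets is \<open>(1 + x) ^ card U\<close>.
  The parameter \<open>x\<close> stays free for later tuning.\<close>

lemma card_small_subsets_le:
  fixes x K :: real
  assumes "finite U" "0 < x" "x \<le> 1"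
  shows "real (card {S \<in> Pow U. real (card S) \<le> K}) \<le> (1 + x) ^ card U * x powr (- K)"
proof -
  let ?S = "{S \<in> Pow U. real (card S) \<le> K}"
  have "real (card ?S) * x powr K = (\<Sum>S\<in>?S. x powr K)" by simp
  also have "\<dots> \<le> (\<Sum>S\<in>?S. x ^ card S)"
  proof (rule sum_mono)
    fix S assume "S \<in> ?S"
    then have "x powr K \<le> x powr real (card S)" using assms by (intro powr_mono') auto
    then show "x powr K \<le> x ^ card S" using assms by (simp add: powr_realpow)
  qed
  also have "\<dots> \<le> (\<Sum>S\<in>Pow U. x ^ card S)"
    by (rule sum_mono2) (use assms in auto)
  also have "\<dots> = (1 + x) ^ card U"
    using prod_add[OF assms(1), of "\<lambda>_. x" "\<lambda>_. 1"] by (simp add: add.commute)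
  finally show ?thesis using assms by (simp add: powr_minus field_simps)
qed

text \<open>A matroid of known rank is recovered from the ranks of the flats in a flat cover: an
  \<open>r\<close>-set is a non-basis if and only if it meets one of them in more elements than its rank.\<close>

lemma card_matroids_small_flat_cover_le:
  fixes x K :: real
  assumes A: "A \<subseteq> matroids_on_rank n r"
    and cover: "\<And>M. M \<in> A \<Longrightarrow> \<exists>\<F>. flat_cover M \<F> \<and> real (card \<F>) \<le> K"
    and x: "0 < x" "x \<le> 1"
  shows "real (card A) \<le> (1 + x) ^ (2 ^ n * (n + 1)) * x powr (- K)"
proof -
  define U :: "(nat set \<times> nat) set" where "U = Pow {1..n} \<times> {0..n}"
  have U: "finite U" "card U = 2 ^ n * (n + 1)"
    by (auto simp: U_def card_cartesian_product card_Pow)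
  obtain \<Phi> where \<Phi>: "\<And>M. M \<in> A \<Longrightarrow> flat_cover M (\<Phi> M) \<and> real (card (\<Phi> M)) \<le> K"
    using cover by metis
  define e where "e = (\<lambda>M. (\<lambda>F. (F, rank_of M F)) ` \<Phi> M)"
  have mem: "is_matroid M \<and> ground M = {1..n} \<and> rank M = r" if "M \<in> A" for M
    using that A by (auto simp: matroids_on_rank_def matroids_on_def)
  \<comment> \<open>The right-hand side involves \<open>M\<close> only through \<open>e M\<close>,
    which makes the encoding \<open>e\<close> injective.\<close>
  have nb: "non_basis M X \<longleftrightarrow>
      X \<subseteq> {1..n} \<and> card X = r \<and> (\<exists>(F, j) \<in> e M. j < card (X \<inter> F))" if M: "M \<in> A" for M X
  proof -
    have M': "is_matroid M" "ground M = {1..n}" "rank M = r"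
      using mem[OF M] by auto
    have "(\<exists>(F, j) \<in> e M. j < card (X \<inter> F)) \<longleftrightarrow> (\<exists>F \<in> \<Phi> M. covers M F X)"
      by (auto simp: e_def covers_def)
    moreover have "non_basis M X \<Longrightarrow> \<exists>F \<in> \<Phi> M. covers M F X"
      using \<Phi>[OF M] by (auto simp: flat_cover_def)
    moreover have "\<exists>F \<in> \<Phi> M. covers M F X \<Longrightarrow> X \<notin> indep M"
      using \<Phi>[OF M] not_indep_if_covers[OF M'(1)] by (auto simp: flat_cover_def)
    ultimately show ?thesis
      unfolding non_basis_iff[OF M'(1)] using M' by auto
  qed
  have "inj_on e A"
  proof (rule inj_onI)
    fix M N assume *: "M \<in> A" "N \<in> A" "e M = e N"
    have "is_matroid M" "is_matroid N" "ground M = ground N" "rank M = rank N"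
      using mem[OF *(1)] mem[OF *(2)] by metis+
    then show "M = N"
      by (rule matroid_eqI) (use * nb in simp)
  qed
  moreover have "e ` A \<subseteq> {S \<in> Pow U. real (card S) \<le> K}"
  proof
    fix S assume "S \<in> e ` A"
    then obtain M where M: "M \<in> A" "S = e M" by auto
    have M': "is_matroid M" "ground M = {1..n}"
      using mem[OF M(1)] by auto
    have fin: "finite (\<Phi> M)" using finite_flat_cover[OF M'(1)] \<Phi>[OF M(1)] by blast
    have "F \<subseteq> {1..n} \<and> rank_of M F \<le> n" if "F \<in> \<Phi> M" for F
    proof -
      have F: "F \<subseteq> {1..n}" using that \<Phi>[OF M(1)] flat_cover_bounded[OF M'(1)] M'(2) by blast
      then have "rank_of M F \<le> card F"
        by (intro rank_of_le_card[OF M'(1)]) (auto intro: finite_subset)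
      also have "\<dots> \<le> n" using card_mono[OF _ F] by simp
      finally show ?thesis using F by simp
    qed
    then have "S \<subseteq> U" using M by (auto simp: e_def U_def)
    moreover have "card S \<le> card (\<Phi> M)" using M fin by (simp add: e_def card_image_le)
    ultimately show "S \<in> {S \<in> Pow U. real (card S) \<le> K}" using \<Phi>[OF M(1)] by auto
  qed
  ultimately have "card A \<le> card {S \<in> Pow U. real (card S) \<le> K}"
    using U by (intro card_inj_on_le) auto
  then have "real (card A) \<le> real (card {S \<in> Pow U. real (card S) \<le> K})" by simp
  also have "\<dots> \<le> (1 + x) ^ card U * x powr (- K)"
    using card_small_subsets_le[OF U(1) x] .
  finally show ?thesis using U by simp
qed

section \<open>Flat covers from contractions by a greedy family\<close>

text \<open>By averaging, some \<open>T\<close> hits at least the fraction \<open>d / card Q\<close>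
  of the elements not yet hit; picking such a \<open>T\<close> multiplies the remainder by at most
  \<open>1 - d / card Q\<close>.\<close>

lemma greedy_cover:
  fixes R :: "'a \<Rightarrow> 'b \<Rightarrow> bool" and d :: nat
  assumes fin: "finite P" "finite Q" and deg: "\<And>x. x \<in> P \<Longrightarrow> d \<le> card {T \<in> Q. R x T}"
    and d: "d \<le> card Q" "Q \<noteq> {}"
  shows "\<exists>S \<subseteq> Q. card S \<le> m \<and>
    real (card {x \<in> P. \<not> (\<exists>T\<in>S. R x T)}) \<le> real (card P) * (1 - d / card Q) ^ m"
proof (induction m)
  case 0
  show ?case by (intro exI[of _ "{}"]) simp
next
  case (Suc m)
  then obtain S where S: "S \<subseteq> Q" "card S \<le> m"
    "real (card {x \<in> P. \<not> (\<exists>T\<in>S. R x T)}) \<le> real (card P) * (1 - d / card Q) ^ m" by blast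
  define U where "U = {x \<in> P. \<not> (\<exists>T\<in>S. R x T)}"
  have U: "finite U" "U \<subseteq> P" using fin by (auto simp: U_def)
  have Q: "card Q > 0" using d fin by (simp add: card_gt_0_iff)
  \<comment> \<open>If every \<open>T\<close> fell short, counting the related pairs in
    \<open>U\<close> and \<open>Q\<close> from both sides would give a contradiction.\<close>
  have "\<exists>T\<in>Q. d * card U \<le> card {x \<in> U. R x T} * card Q"
  proof (rule ccontr)
    assume "\<not> ?thesis"
    then have lt: "\<And>T. T \<in> Q \<Longrightarrow> card {x \<in> U. R x T} * card Q < d * card U" by force
    have "d * card U * card Q \<le> (\<Sum>x\<in>U. card {T \<in> Q. R x T}) * card Q"
      using sum_bounded_below[of U d "\<lambda>x. card {T \<in> Q. R x T}"] deg U by (simp add: mult.commute subset_iff)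
    also have "(\<Sum>x\<in>U. card {T \<in> Q. R x T}) = (\<Sum>T\<in>Q. card {x \<in> U. R x T})"
      using sum_multicount_gen[OF U(1) fin(2), of R "\<lambda>T. card {x \<in> U. R x T}"] by simp
    also have "\<dots> * card Q = (\<Sum>T\<in>Q. card {x \<in> U. R x T} * card Q)"
      by (simp add: sum_distrib_right)
    also have "\<dots> < (\<Sum>T\<in>Q. d * card U)"
      using lt fin d by (intro sum_strict_mono) auto
    finally show False by (simp add: mult.commute)
  qed
  then obtain T where T: "T \<in> Q" "d * card U \<le> card {x \<in> U. R x T} * card Q" by blast
  have eq: "{x \<in> P. \<not> (\<exists>T'\<in>insert T S. R x T')} = U - {x \<in> U. R x T}"
    by (auto simp: U_def)
  have "real (card {x \<in> P. \<not> (\<exists>T'\<in>insert T S. R x T')}) = real (card U) - card {x \<in> U. R x T}"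
    unfolding eq using U by (subst card_Diff_subset) (auto intro!: of_nat_diff card_mono)
  also have "real d * card U \<le> real (card {x \<in> U. R x T}) * card Q"
    using T(2) by (metis of_nat_le_iff of_nat_mult)
  then have "real (card U) - card {x \<in> U. R x T} \<le> real (card U) * (1 - d / card Q)"
    using Q by (simp add: field_simps)
  also have "\<dots> \<le> real (card P) * (1 - d / card Q) ^ m * (1 - d / card Q)"
    using S(3) d Q by (intro mult_right_mono) (auto simp: U_def)
  finally have "real (card {x \<in> P. \<not> (\<exists>T'\<in>insert T S. R x T')}) \<le>
    real (card P) * (1 - d / card Q) ^ Suc m" by (simp add: mult_ac)
  moreover have "card (insert T S) \<le> Suc m"
    using S(2) card_insert_le_m1[of "Suc m" S T] by simp
  ultimately show ?case using S(1) T(1) by (intro exI[of _ "insert T S"]) auto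
qed

text \<open>After \<open>m\<close> rounds, with \<open>m\<close> equal to
  \<open>card Q / d * ln d\<close> rounded up, the factor is at most
  \<open>exp (- ln d) = 1 / d\<close>; the rounding costs the \<open>+ 1\<close>.\<close>

lemma greedy_cover_log:
  fixes R :: "'a \<Rightarrow> 'b \<Rightarrow> bool" and d :: nat
  assumes fin: "finite P" "finite Q" and deg: "\<And>x. x \<in> P \<Longrightarrow> d \<le> card {T \<in> Q. R x T}"
    and d: "1 \<le> d" "d \<le> card Q"
  shows "\<exists>S \<subseteq> Q. real (card S) \<le> card Q / d * ln d + 1 \<and>
    real (card {x \<in> P. \<not> (\<exists>T\<in>S. R x T)}) \<le> card P / d"
proof -
  define m where "m = nat \<lceil>card Q / d * ln (real d)\<rceil>"
  have nn: "0 \<le> card Q / d * ln (real d)" using d by simp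
  then have m: "real m \<ge> card Q / d * ln d" "real m \<le> card Q / d * ln d + 1"
    unfolding m_def by linarith+
  have Q: "card Q > 0" "Q \<noteq> {}" using d by auto
  have "(1 - d / card Q) ^ m \<le> exp (- (d / card Q)) ^ m"
    using d Q exp_ge_add_one_self[of "- (d / card Q)"] by (intro power_mono) auto
  also have "\<dots> = exp (- (real m * (d / card Q)))" by (simp flip: exp_of_nat_mult)
  also have "\<dots> \<le> exp (- ln d)"
  proof -
    have "ln d = card Q / d * ln d * (d / card Q)" using d Q by simp
    also have "\<dots> \<le> real m * (d / card Q)" using m(1) by (intro mult_right_mono) auto
    finally show ?thesis by simp
  qed
  also have "\<dots> = 1 / d" using d by (simp add: exp_minus inverse_eq_divide)
  finally have pow: "real (card P) * (1 - d / card Q) ^ m \<le> card P / d"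
    by (metis mult_left_mono of_nat_0_le_iff times_divide_eq_right mult.right_neutral)
  have "\<exists>S \<subseteq> Q. card S \<le> m \<and>
    real (card {x \<in> P. \<not> (\<exists>T\<in>S. R x T)}) \<le> real (card P) * (1 - d / card Q) ^ m"
    by (rule greedy_cover[OF fin _ d(2) Q(2)]) (rule deg)
  then obtain S where S: "S \<subseteq> Q" "card S \<le> m"
    "real (card {x \<in> P. \<not> (\<exists>T\<in>S. R x T)}) \<le> real (card P) * (1 - d / card Q) ^ m"
    by (elim exE conjE)
  have "real (card S) \<le> card Q / d * ln d + 1" using S(2) m(2) by linarith
  with S(1) order_trans[OF S(3) pow] show ?thesis by (intro exI[of _ S] conjI)
qed

text \<open>The greedy family is taken for inclusion of \<open>(r-s)\<close>-sets in
  \<open>r\<close>-sets, where \<open>r = rank M\<close>; each \<open>r\<close>-set has exactly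
  \<open>d\<close> such subsets. The first summand pays \<open>W\<close> per chosen
  \<open>T\<close>, the second one flat per missed \<open>r\<close>-set. The condition
  \<open>W \<ge> 1\<close> lets \<open>W\<close> also pay for a dependent \<open>T\<close>.\<close>

lemma flat_cover_from_contractions:
  fixes M :: "'a matroid" and W :: real
  assumes M: "is_matroid M" and s: "s \<le> rank M"
    and W: "W \<ge> 1"
    and contract: "\<And>T. T \<in> indep M \<Longrightarrow> card T = rank M - s \<Longrightarrow>
      is_matroid (contract M T) \<and> real (cover_complexity (contract M T)) \<le> W"
  defines "n \<equiv> card (ground M)" and "d \<equiv> rank M choose s"
  shows "\<exists>\<F>. flat_cover M \<F> \<and>
    real (card \<F>) \<le> ((n choose (rank M - s)) / d * ln d + 1) * W + (n choose rank M) / d"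
proof -
  define P where "P = {X. X \<subseteq> ground M \<and> card X = rank M}"
  define Q where "Q = {T. T \<subseteq> ground M \<and> card T = rank M - s}"
  note finE = finite_ground[OF M]
  have PQ: "finite P" "finite Q" "card P = n choose rank M" "card Q = n choose (rank M - s)"
    using finE by (auto simp: P_def Q_def n_def n_subsets)
  have deg: "card {T \<in> Q. T \<subseteq> X} = d" if "X \<in> P" for X
  proof -
    have X: "X \<subseteq> ground M" "finite X" "card X = rank M"
      using that finE finite_subset by (auto simp: P_def)
    then have "{T \<in> Q. T \<subseteq> X} = {T. T \<subseteq> X \<and> card T = rank M - s}"
      by (auto simp: Q_def)
    then show ?thesis using n_subsets[OF X(2)] X(3) s by (simp add: d_def binomial_symmetric[OF s])
  qed
  have d1: "1 \<le> d" using s by (simp add: d_def Suc_le_eq zero_less_binomial)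
  \<comment> \<open>A basis witnesses that \<open>P\<close> is nonempty, which yields
    \<open>d \<le> card Q\<close>.\<close>
  obtain B where "B \<in> indep M" "card B = rank M" using rank_of_attained[OF M] by blast
  then have "B \<in> P" using indep_subset_ground[OF M] by (simp add: P_def)
  then have "d \<le> card Q" using deg[of B] card_mono[OF PQ(2), of "{T \<in> Q. T \<subseteq> B}"] by auto
  then obtain S where S: "S \<subseteq> Q" "real (card S) \<le> card Q / d * ln d + 1"
    "real (card {X \<in> P. \<not> (\<exists>T\<in>S. T \<subseteq> X)}) \<le> card P / d"
    using greedy_cover_log[OF PQ(1,2), of d "\<lambda>X T. T \<subseteq> X"] deg d1 by force
  have finS: "finite S" using S(1) PQ(2) finite_subset by blast
  have "\<exists>\<F>. finite \<F> \<and> (\<forall>F\<in>\<F>. flat M F) \<and> real (card \<F>) \<le> W \<and>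
      (\<forall>X. non_basis M X \<longrightarrow> T \<subseteq> X \<longrightarrow> (\<exists>F\<in>\<F>. covers M F X))" if "T \<in> S" for T
  proof -
    have T: "T \<subseteq> ground M" "card T = rank M - s" using that S(1) by (auto simp: Q_def)
    then obtain \<F> where \<F>: "finite \<F>" "\<forall>F\<in>\<F>. flat M F"
        "card \<F> \<le> (if T \<in> indep M then cover_complexity (contract M T) else 1)"
        "\<forall>X. non_basis M X \<longrightarrow> T \<subseteq> X \<longrightarrow> (\<exists>F\<in>\<F>. covers M F X)"
      using local_flat_cover[OF M T(1)] contract by metis
    have "real (card \<F>) \<le> W"
      using \<F>(3) contract[of T] T(2) W by (auto split: if_splits)
    with \<F> show ?thesis by blast
  qed
  then obtain \<Phi> where \<Phi>: "\<And>T. T \<in> S \<Longrightarrow> finite (\<Phi> T) \<and> (\<forall>F\<in>\<Phi> T. flat M F) \<and>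
      real (card (\<Phi> T)) \<le> W \<and> (\<forall>X. non_basis M X \<longrightarrow> T \<subseteq> X \<longrightarrow> (\<exists>F\<in>\<Phi> T. covers M F X))"
    by metis
  define V where "V = {X \<in> P. \<not> (\<exists>T\<in>S. T \<subseteq> X)}"
  define V' where "V' = {X \<in> V. non_basis M X}"
  have finV: "finite V" "finite V'" using PQ by (auto simp: V_def V'_def)
  have "\<exists>F. flat M F \<and> covers M F X" if "X \<in> V'" for X
    using that dependent_covered[OF M, of X] finE
    by (auto simp: V'_def non_basis_iff[OF M] intro: finite_subset)
  then obtain h where h: "\<And>X. X \<in> V' \<Longrightarrow> flat M (h X) \<and> covers M (h X) X" by metis
  define \<F> where "\<F> = (\<Union>T\<in>S. \<Phi> T) \<union> h ` V'"
  have "flat_cover M \<F>"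
    unfolding flat_cover_def
  proof (intro conjI ballI allI impI)
    fix F assume "F \<in> \<F>"
    then show "flat M F" using \<Phi> h by (auto simp: \<F>_def)
  next
    fix X assume X: "non_basis M X"
    then have "X \<in> P" by (simp add: P_def non_basis_def)
    show "\<exists>F\<in>\<F>. covers M F X"
    proof (cases "\<exists>T\<in>S. T \<subseteq> X")
      case True
      then obtain T where T: "T \<in> S" "T \<subseteq> X" by blast
      with \<Phi>[OF T(1)] X obtain F where "F \<in> \<Phi> T" "covers M F X" by blast
      with T(1) show ?thesis by (intro bexI[of _ F]) (auto simp: \<F>_def)
    next
      case False
      then have "X \<in> V'" using X \<open>X \<in> P\<close> by (simp add: V'_def V_def)
      with h show ?thesis by (intro bexI[of _ "h X"]) (auto simp: \<F>_def)
    qed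
  qed
  moreover have "real (card \<F>) \<le> (card Q / d * ln d + 1) * W + card P / d"
  proof -
    have "card \<F> \<le> card (\<Union>T\<in>S. \<Phi> T) + card (h ` V')" unfolding \<F>_def by (rule card_Un_le)
    also have "\<dots> \<le> (\<Sum>T\<in>S. card (\<Phi> T)) + card V'"
      using card_UN_le[OF finS] card_image_le[OF finV(2)] by (rule add_mono)
    also have "\<dots> \<le> (\<Sum>T\<in>S. card (\<Phi> T)) + card V"
      using finV by (auto intro!: card_mono simp: V'_def)
    finally have "real (card \<F>) \<le> real ((\<Sum>T\<in>S. card (\<Phi> T)) + card V)" by (rule of_nat_mono)
    also have "\<dots> = (\<Sum>T\<in>S. real (card (\<Phi> T))) + card V" by simp
    also have "\<dots> \<le> real (card S) * W + card P / d"
      using sum_bounded_above[of S "\<lambda>T. real (card (\<Phi> T))" W] \<Phi> S(3) by (auto simp: V_def intro!: add_mono)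
    also have "\<dots> \<le> (card Q / d * ln d + 1) * W + card P / d"
      using S(2) W by (intro add_right_mono mult_right_mono) auto
    finally show ?thesis .
  qed
  ultimately show ?thesis using PQ by metis
qed

section \<open>Binomial estimates\<close>

text \<open>Squaring avoids the root. Consecutive central coefficients have ratio
  \<open>2 * (2 * m + 1) / (m + 1)\<close>.\<close>

lemma central_binomial_squared_le: "real (2 * m choose m) ^ 2 * (2 * real m + 1) \<le> 16 ^ m"
proof (induction m)
  case 0
  show ?case by simp
next
  case (Suc m)
  define b where "b = real (2 * m choose m)"
  have "(Suc (2 * m) choose m) = (Suc (2 * m) choose Suc m)"
    by (subst binomial_symmetric) auto
  moreover have "2 * Suc m choose Suc m = (Suc (2 * m) choose m) + (Suc (2 * m) choose Suc m)"
    using binomial_Suc_Suc[of "Suc (2 * m)" m] by (metis mult_Suc_right add_2_eq_Suc)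
  ultimately have "2 * Suc m choose Suc m = 2 * (Suc (2 * m) choose Suc m)" by linarith
  then have "real (2 * Suc m choose Suc m) = 2 * real (Suc (2 * m) choose Suc m)"
    by (metis of_nat_mult of_nat_numeral)
  moreover have "real (Suc m) * real (Suc (2 * m) choose Suc m) = real (Suc (2 * m)) * b"
    unfolding b_def using Suc_times_binomial[of m "2 * m"] by (metis of_nat_mult)
  ultimately have "(real m + 1) * real (2 * Suc m choose Suc m) = 2 * (2 * real m + 1) * b"
    by (simp add: algebra_simps del: binomial_Suc_Suc)
  then have eq: "real (2 * Suc m choose Suc m) = 2 * (2 * real m + 1) * b / (real m + 1)"
    by (simp add: field_simps)
  have "real (2 * Suc m choose Suc m) ^ 2 * (2 * real (Suc m) + 1)
      = (b ^ 2 * (2 * real m + 1)) * (4 * (2 * real m + 1) * (2 * real m + 3) / (real m + 1) ^ 2)"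
    unfolding eq by (simp add: power2_eq_square field_simps)
  also have "\<dots> \<le> 16 ^ m * 16"
  proof (rule mult_mono)
    show "b ^ 2 * (2 * real m + 1) \<le> 16 ^ m" using Suc by (simp add: b_def)
    \<comment> \<open>Indeed \<open>(2 * m + 1) * (2 * m + 3) = 4 * (m + 1)^2 - 1\<close>.\<close>
    show "4 * (2 * real m + 1) * (2 * real m + 3) / (real m + 1) ^ 2 \<le> 16"
      by (subst pos_divide_le_eq) (simp_all add: power2_eq_square algebra_simps add_pos_nonneg)
  qed auto
  finally show ?case by simp
qed

lemma binomial_le_pow2_over_sqrt:
  assumes "n > 0"
  shows "real (n choose k) \<le> 2 * 2 ^ n / sqrt n"
proof -
  define m where "m = n div 2"
  have n: "n = 2 * m \<or> n = 2 * m + 1" by (auto simp: m_def)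
  have central: "real (2 * m choose m) * sqrt (2 * real m + 1) \<le> 4 ^ m"
  proof (rule power2_le_imp_le)
    show "(real (2 * m choose m) * sqrt (2 * real m + 1))\<^sup>2 \<le> (4 ^ m)\<^sup>2"
      using central_binomial_squared_le[of m] power_mult[of "4 :: real" 2 m]
      by (simp add: power_mult_distrib power_even_eq)
  qed simp
  have "real (n choose k) * sqrt n \<le> real (n choose m) * sqrt (2 * real m + 1)"
    using n binomial_maximum[of n k] by (intro mult_mono) (auto simp: m_def)
  also have "\<dots> \<le> 2 * 2 ^ n"
  proof (cases "n = 2 * m")
    case True
    then show ?thesis using order_trans[OF central, of "2 * 4 ^ m"] by (simp add: power_mult)
  next
    case False
    with n have n': "n = Suc (2 * m)" by simp
    \<comment> \<open>Pascal's rule writes the odd case as two coefficients of row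
      \<open>2 * m\<close>, each at most the central one; it needs a positive lower index, hence the
      separate case 0.\<close>
    have "(n choose m) \<le> 2 * (2 * m choose m)"
    proof (cases m)
      case 0
      then show ?thesis by simp
    next
      case (Suc j)
      then show ?thesis using n' binomial_maximum'[of m j] by simp
    qed
    then have "real (n choose m) \<le> 2 * real (2 * m choose m)" by (metis of_nat_le_iff of_nat_mult of_nat_numeral)
    then have "real (n choose m) * sqrt (2 * real m + 1) \<le> 2 * (real (2 * m choose m) * sqrt (2 * real m + 1))"
      by (simp add: mult_right_mono flip: mult.assoc)
    also have "\<dots> \<le> 2 * 4 ^ m" using central by simp
    also have "\<dots> = 2 ^ n" by (simp add: n' power_mult)
    also have "\<dots> \<le> 2 * 2 ^ n" by simp
    finally show ?thesis .
  qed
  finally show ?thesis using assms by (simp add: field_simps)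
qed

text \<open>Compare the \<open>r\<close>-th term of \<open>(1 + x)^n\<close> at \<open>x = 1/2\<close>, and use \<open>2 \<le> (6/5)^4\<close>.\<close>

lemma binomial_le_small_exp:
  assumes "4 * r \<le> n"
  shows "real (n choose r) \<le> (9/5) ^ n"
proof -
  have "real (n choose r) * (1/2) ^ r \<le> (\<Sum>k\<le>n. real (n choose k) * (1/2) ^ k)"
    using assms by (intro member_le_sum) auto
  also have "\<dots> = (3/2) ^ n" using binomial_ring[of "1/2 :: real" 1 n] by simp
  finally have "real (n choose r) \<le> (3/2) ^ n * 2 ^ r" by (simp add: field_simps power_divide)
  also have "(2::real) ^ r \<le> ((6/5) ^ 4) ^ r" by (rule power_mono) (auto simp: power_divide)
  also have "\<dots> = (6/5) ^ (4 * r)" by (rule power_mult[symmetric])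
  also have "\<dots> \<le> (6/5) ^ n" using assms by (intro power_increasing) auto
  also have "(3/2) ^ n * (6/5) ^ n = (9/5 :: real) ^ n" by (simp flip: power_mult_distrib)
  finally show ?thesis by simp
qed

lemma binomial_le_small_exp':
  assumes "r \<le> n" "4 * r \<le> n \<or> 3 * n \<le> 4 * r"
  shows "real (n choose r) \<le> (9/5) ^ n"
  using assms binomial_le_small_exp[of r n] binomial_le_small_exp[of "n - r" n]
    binomial_symmetric[OF assms(1)] by auto

section \<open>Asymptotics\<close>

lemma matroids_on_eq_Union: "matroids_on n = (\<Union>r\<le>n. matroids_on_rank n r)"
proof -
  have "rank M \<le> n" if "M \<in> matroids_on n" for M
    using that rank_of_le_card[of M "ground M"] by (auto simp: matroids_on_def)
  then show ?thesis by (auto simp: matroids_on_rank_def)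
qed

text \<open>The denominator is at least \<open>(r / s) ^ s\<close>, and \<open>r \<ge> n / 4\<close>
  turns this into a multiple of \<open>n ^ s\<close>; the numerator contributes
  \<open>2 ^ n / sqrt n\<close>.\<close>

lemma binomial_over_binomial_le:
  fixes r s n k :: nat
  assumes "n > 0" "n \<le> 4 * r" "1 \<le> s" "s \<le> r"
  shows "(n choose k) / (r choose s) \<le> 2 * (4 * real s) ^ s * (2 ^ n * real n powr (- 1/2 - real s))"
proof -
  have "(real n / (4 * real s)) ^ s \<le> (real r / real s) ^ s"
    using assms by (intro power_mono) (auto simp: field_simps)
  also have "\<dots> \<le> real (r choose s)"
    by (rule binomial_ge_n_over_k_pow_k[OF assms(4)])
  finally have den: "(real n / (4 * real s)) ^ s \<le> real (r choose s)" .
  have "(n choose k) / (r choose s) \<le> (2 * 2 ^ n / sqrt n) / (real n / (4 * real s)) ^ s"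
    using assms den binomial_le_pow2_over_sqrt[of n k] by (intro frac_le) auto
  also have "\<dots> = 2 * (4 * real s) ^ s * (2 ^ n / (sqrt n * real n ^ s))"
    by (simp add: power_divide field_simps)
  also have "sqrt n * real n ^ s = real n powr (1/2 + real s)"
    using assms by (simp add: powr_add powr_half_sqrt powr_realpow)
  also have "2 ^ n / real n powr (1/2 + real s) = 2 ^ n * real n powr (- 1/2 - real s)"
    using powr_minus_divide[of "real n" "1/2 + real s"] by simp
  finally show ?thesis .
qed

section \<open>Members of a contraction-closed class with bounded cover complexity in rank
  \<open>s\<close>\<close>

context
  fixes \<M> :: "nat matroid set" and s :: nat and c \<epsilon> :: real
  assumes closed: "matroid_class \<M>" "contraction_closed \<M>"
    and pos: "s \<ge> 1" "c > 0" "\<epsilon> > 0"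
    and bound: "\<And>n. \<M> \<inter> matroids_on_rank n s \<noteq> {} \<Longrightarrow>
           real (Max (cover_complexity ` (\<M> \<inter> matroids_on_rank n s)))
             \<le> c * real n powr (real s - 1 - \<epsilon>)"
begin

text \<open>The contraction has rank \<open>s\<close> on \<open>n - (r - s)\<close> elements. A copy
  relabelled to an initial segment stays in the class by closure under isomorphism, so the assumed
  bound applies to it.\<close>

lemma contraction_cover_complexity_le:
  assumes M: "M \<in> \<M>" "M \<in> matroids_on_rank n r" and T: "T \<in> indep M" "card T = r - s" and "s \<le> r"
  shows "is_matroid (contract M T) \<and>
    real (cover_complexity (contract M T)) \<le> c * real (n - (r - s)) powr (real s - 1 - \<epsilon>)"
proof
  have M': "is_matroid M" "ground M = {1..n}" "rank M = r"
    using M(2) by (auto simp: matroids_on_rank_def matroids_on_def)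
  define N where "N = contract M T"
  define n' where "n' = n - (r - s)"
  have sub: "T \<subseteq> ground M" using indep_subset_ground[OF M'(1) T(1)] .
  have "N \<in> \<M>" using closed(2) M(1) sub unfolding contraction_closed_def N_def by blast
  then show N: "is_matroid (contract M T)" using closed(1) unfolding matroid_class_def N_def by blast
  have "rank N = s"
    using rank_contract[OF M'(1) T(1) N] M'(3) T(2) \<open>s \<le> r\<close> by (simp add: N_def)
  have "card (ground N) = n'"
    using sub T(2) M'(2) finite_indep[OF M'(1) T(1)]
    by (simp add: N_def contract_def card_Diff_subset n'_def)
  then obtain f where f: "bij_betw f (ground N) {1..n'}"
    using finite_same_card_bij[of "ground N" "{1..n'}"] finite_ground[OF N] by (auto simp: N_def)
  have inj: "inj_on f (ground N)" and img: "f ` ground N = {1..n'}"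
    using f by (auto simp: bij_betw_def)
  note N_mat = N[folded N_def]
  let ?S = "\<M> \<inter> matroids_on_rank n' s"
  have "relabel f N \<in> \<M>"
    using closed(1) \<open>N \<in> \<M>\<close> relabel_is_matroid[OF N_mat inj] relabel_isomorphic[OF N_mat inj]
    unfolding matroid_class_def by blast
  moreover have "relabel f N \<in> matroids_on_rank n' s"
    using relabel_rank[OF N_mat inj] \<open>rank N = s\<close> relabel_is_matroid[OF N_mat inj] img
    by (simp add: matroids_on_rank_def matroids_on_def relabel_def)
  ultimately have mem: "relabel f N \<in> ?S" by blast
  have "cover_complexity N \<le> cover_complexity (relabel f N)"
    by (rule cover_complexity_le_relabel[OF N_mat inj])
  also have "\<dots> \<le> Max (cover_complexity ` ?S)"
    using mem finite_matroids_on_rank by (intro Max_ge) auto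
  finally show "real (cover_complexity (contract M T)) \<le> c * real (n - (r - s)) powr (real s - 1 - \<epsilon>)"
    using bound[of n'] mem by (fastforce simp: N_def n'_def)
qed

text \<open>With \<open>D = 2 * (4 * s) ^ s\<close>, the summand
  \<open>(1 + c) * (D * s + 1)\<close> comes from the greedy family and \<open>D\<close> from the
  exceptional non-bases.\<close>

definition cover_const :: real where
  "cover_const = (1 + c) * (2 * (4 * real s) ^ s * real s + 1) + 2 * (4 * real s) ^ s"

lemma cover_const_pos: "cover_const > 0"
  using pos by (auto simp: cover_const_def intro!: add_pos_nonneg mult_pos_pos)

lemma small_flat_cover_nonneg_exponent:
  assumes M: "M \<in> \<M>" "M \<in> matroids_on_rank n r"
    and exponent: "\<epsilon> \<le> real s - 1"
    and r: "s \<le> r" "r \<le> n" "n \<le> 4 * r" and n: "n \<ge> 3"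
    and large: "real n powr (real s - 1 - \<epsilon>) \<le> 1 / real n powr (3/2 + \<epsilon>) * 2 ^ n"
  shows "\<exists>\<F>. flat_cover M \<F> \<and>
    real (card \<F>) \<le> cover_const * (1 / real n powr (3/2 + \<epsilon>) * 2 ^ n) * ln n"
proof -
  define h where "h = 1 / real n powr (3/2 + \<epsilon>) * 2 ^ n"
  \<comment> \<open>The factor \<open>1 + c\<close> instead of \<open>c\<close> ensures
    \<open>W \<ge> 1\<close>, as the exponent is nonnegative.\<close>
  define W where "W = (1 + c) * real n powr (real s - 1 - \<epsilon>)"
  define D where "D = 2 * (4 * real s) ^ s"
  define Y where "Y = 2 ^ n * real n powr (- 1/2 - real s)"
  define d where "d = r choose s"
  have M': "is_matroid M" "ground M = {1..n}" "rank M = r"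
    using M(2) by (auto simp: matroids_on_rank_def matroids_on_def)
  have p1: "real n powr (real s - 1 - \<epsilon>) \<ge> 1"
    using exponent n by (intro ge_one_powr_ge_zero) auto
  have W1: "W \<ge> 1" using mult_mono[of 1 "1 + c" 1, OF _ p1] pos by (simp add: W_def)
  have "is_matroid (contract M T) \<and> real (cover_complexity (contract M T)) \<le> W"
    if T: "T \<in> indep M" "card T = rank M - s" for T
  proof -
    have "c * real (n - (r - s)) powr (real s - 1 - \<epsilon>) \<le> W"
      unfolding W_def using pos exponent by (intro mult_mono powr_mono2) auto
    then show ?thesis
      using contraction_cover_complexity_le[OF M T(1) T(2)[unfolded M'(3)] r(1)] by linarith
  qed
  note * = flat_cover_from_contractions[OF M'(1) r(1)[folded M'(3)] W1 this]
  have "card (ground M) = n" by (simp add: M'(2))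
  with * obtain \<F> where \<F>: "flat_cover M \<F>"
    "real (card \<F>) \<le> ((n choose (r - s)) / d * ln d + 1) * W + (n choose r) / d"
    unfolding d_def M'(3) by auto
  have d1: "1 \<le> d" using r by (simp add: d_def Suc_le_eq zero_less_binomial)
  have ln1: "ln (real n) \<ge> 1"
    using n exp_le by (subst ln_ge_iff) auto
  have "d \<le> r ^ s" unfolding d_def by (rule binomial_le_pow[OF r(1)])
  also have "\<dots> \<le> n ^ s" using r by (intro power_mono) auto
  finally have "real d \<le> real n ^ s" by (metis of_nat_le_iff of_nat_power)
  then have "ln (real d) \<le> ln (real n ^ s)" using d1 n by (subst ln_le_cancel_iff) auto
  then have lnd: "ln (real d) \<le> s * ln n" using n by (simp add: ln_realpow)
  have quot: "(n choose k) / d \<le> D * Y" for k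
    unfolding D_def Y_def d_def using binomial_over_binomial_le[of n r s k] r n pos by simp
  have D0: "D \<ge> 0" and Y0: "Y \<ge> 0" and h0: "h \<ge> 0" by (auto simp: D_def Y_def h_def)
  \<comment> \<open>The exponents \<open>-1/2 - s\<close> and \<open>s - 1 - \<epsilon>\<close> add
    up to \<open>-(3/2 + \<epsilon>)\<close>, so \<open>s\<close> cancels.\<close>
  have YW: "Y * W = (1 + c) * h"
  proof -
    have "real n powr (- 1/2 - real s) * real n powr (real s - 1 - \<epsilon>) = real n powr (- (3/2 + \<epsilon>))"
      by (simp flip: powr_add)
    moreover have "Y * W = (1 + c) * (2 ^ n * (real n powr (- 1/2 - real s) * real n powr (real s - 1 - \<epsilon>)))"
      by (simp add: Y_def W_def)
    ultimately have "Y * W = (1 + c) * (2 ^ n * real n powr (- (3/2 + \<epsilon>)))" by simp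
    then show ?thesis unfolding h_def powr_minus_divide by simp
  qed
  \<comment> \<open>This comparison is equivalent to \<open>\<epsilon> \<le> s - 1\<close> on the
    level of exponents.\<close>
  have Yh: "Y \<le> h"
  proof -
    have "real n powr (- 1/2 - real s) \<le> real n powr (- (3/2 + \<epsilon>))"
      using exponent n by (intro powr_mono) auto
    then have "Y \<le> 2 ^ n * real n powr (- (3/2 + \<epsilon>))" by (simp add: Y_def)
    then show ?thesis unfolding h_def powr_minus_divide by simp
  qed
  \<comment> \<open>Absorbs the \<open>+ 1\<close> caused by rounding up the size of the greedy
    family.\<close>
  have Wh: "W \<le> (1 + c) * h"
    unfolding W_def h_def using large pos by (intro mult_left_mono) auto
  have "(n choose (r - s)) / d * ln d \<le> D * Y * (s * ln n)"
    using quot[of "r - s"] lnd D0 Y0 d1 by (intro mult_mono) auto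
  then have "((n choose (r - s)) / d * ln d + 1) * W \<le> (D * Y * (s * ln n) + 1) * W"
    using W1 by (intro mult_right_mono) auto
  also have "\<dots> = D * s * ln n * (Y * W) + W" by (simp add: algebra_simps)
  also have "\<dots> \<le> D * s * ln n * ((1 + c) * h) + (1 + c) * h" using Wh YW by simp
  finally have "real (card \<F>) \<le> D * s * ln n * ((1 + c) * h) + (1 + c) * h + D * h"
    using \<F>(2) quot[of r] mult_left_mono[OF Yh D0] by linarith
  \<comment> \<open>The terms without a logarithm are absorbed using \<open>ln n \<ge> 1\<close>,
    valid since \<open>n \<ge> 3\<close>.\<close>
  also have "\<dots> \<le> D * s * ln n * ((1 + c) * h) + (1 + c) * h * ln n + D * h * ln n"
  proof -
    have "0 \<le> (1 + c) * h" "0 \<le> D * h" using pos D0 h0 by auto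
    from this[THEN mult_left_mono[OF ln1]] show ?thesis by linarith
  qed
  also have "\<dots> = cover_const * h * ln n"
    by (simp add: cover_const_def D_def algebra_simps)
  finally show ?thesis using \<F>(1) by (auto simp: h_def)
qed

text \<open>With a negative exponent the count above breaks down, since each dependent \<open>T\<close> costs one flat.
  But then \<open>\<kappa> = 0\<close> for all large members of rank \<open>s\<close>, which forces \<open>M\<close> to be uniform.\<close>

lemma no_non_basis_negative_exponent:
  assumes M: "M \<in> \<M>" "M \<in> matroids_on_rank n r"
    and exponent: "\<epsilon> > real s - 1"
    and r: "s \<le> r" "r \<le> n" "4 * r \<le> 3 * n" and n: "n > 0"
    and large: "c * (real n / 4) powr (real s - 1 - \<epsilon>) < 1"
  shows "\<not> non_basis M X"
proof (rule uniform_if_contractions_uniform)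
  have M': "is_matroid M" "rank M = r"
    using M(2) by (auto simp: matroids_on_rank_def matroids_on_def)
  show "is_matroid M" "s \<le> rank M" "1 \<le> s" using M' r pos by auto
  fix T assume T: "T \<in> indep M" "card T = rank M - s"
  \<comment> \<open>As \<open>r\<close> is at most \<open>3n/4\<close>, the contraction keeps at
    least \<open>n/4\<close> elements; under a negative exponent the bound is largest at
    \<open>n/4\<close>.\<close>
  have "real n / 4 \<le> real (n - (r - s))" using r by (simp add: of_nat_diff)
  then have "real (n - (r - s)) powr (real s - 1 - \<epsilon>) \<le> (real n / 4) powr (real s - 1 - \<epsilon>)"
    using n exponent by (intro powr_mono2') auto
  then have "c * real (n - (r - s)) powr (real s - 1 - \<epsilon>) < 1"
    using large pos by (meson le_less_trans mult_left_mono less_imp_le)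
  with contraction_cover_complexity_le[OF M T(1) T(2)[unfolded M'(2)] r(1)]
  have "is_matroid (contract M T)" "cover_complexity (contract M T) = 0" by auto
  then show "is_matroid (contract M T) \<and> (\<forall>Y. \<not> non_basis (contract M T) Y)"
    using no_non_basis_if_cover_complexity_zero by blast
qed

text \<open>Both signs of the exponent provide a flat cover of size at most \<open>K\<close>, the
  empty one if the exponent is negative; the encoding bound is then evaluated at a tuned
  \<open>x\<close>.\<close>

lemma card_middle_rank_le:
  assumes n: "n \<ge> 3" and r: "s \<le> r" "r \<le> n" "n \<le> 4 * r" "4 * r \<le> 3 * n"
    and large1: "\<epsilon> \<le> real s - 1 \<Longrightarrow> real n powr (real s - 1 - \<epsilon>) \<le> 1 / real n powr (3/2 + \<epsilon>) * 2 ^ n"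
    and large2: "\<epsilon> > real s - 1 \<Longrightarrow> c * (real n / 4) powr (real s - 1 - \<epsilon>) < 1"
  shows "real (card (\<M> \<inter> matroids_on_rank n r)) \<le>
    2 powr ((4 + cover_const * (5/2 + \<epsilon>)) * (1 / real n powr (3/2 + \<epsilon>) * 2 ^ n * (log 2 n)\<^sup>2))"
proof -
  define h where "h = 1 / real n powr (3/2 + \<epsilon>) * 2 ^ n"
  define K where "K = cover_const * h * ln n"
  \<comment> \<open>Chosen so that \<open>2^n (n+1) x\<close> is \<open>O(h)\<close> while \<open>log (1/x)\<close> is only \<open>O(log n)\<close>.\<close>
  define x where "x = real n powr (- (5/2 + \<epsilon>))"
  define L where "L = log 2 n"
  have h0: "h \<ge> 0" by (simp add: h_def)
  have ln0: "ln (real n) \<ge> 0" using n by simp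
  have L1: "L \<ge> 1" using n by (simp add: L_def le_log_iff)
  have lnL: "ln (real n) \<le> L"
    using ln0 ln_2_less_1 by (simp add: L_def log_def field_simps mult_left_le)
  have x: "0 < x" "x \<le> 1"
    using n pos powr_mono[of "- (5/2 + \<epsilon>)" 0 "real n"] by (auto simp: x_def)
  have cover: "\<exists>\<F>. flat_cover M \<F> \<and> real (card \<F>) \<le> K" if M: "M \<in> \<M> \<inter> matroids_on_rank n r" for M
  proof (cases "\<epsilon> \<le> real s - 1")
    case True
    then show ?thesis
      using small_flat_cover_nonneg_exponent[of M n r] M r n large1 by (auto simp: K_def h_def)
  next
    case False
    then have "\<not> non_basis M X" for X
      using no_non_basis_negative_exponent[of M n r X] M r n large2 by auto
    then have "flat_cover M {}" by (simp add: flat_cover_def)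
    then show ?thesis
      using cover_const_pos h0 ln0 by (intro exI[of _ "{}"]) (simp add: K_def)
  qed
  have "real (card (\<M> \<inter> matroids_on_rank n r)) \<le> (1 + x) ^ (2 ^ n * (n + 1)) * x powr (- K)"
    by (rule card_matroids_small_flat_cover_le[OF _ cover x]) auto
  also have "(1 + x) ^ (2 ^ n * (n + 1)) \<le> exp x ^ (2 ^ n * (n + 1))"
    using x by (intro power_mono) auto
  also have "\<dots> = exp (2 ^ n * (real n + 1) * x)"
    by (subst exp_of_nat_mult[symmetric]) (simp add: algebra_simps)
  also have "\<dots> \<le> 2 powr (4 * h)"
  proof -
    have "2 ^ n * (real n + 1) * x \<le> 2 ^ n * (2 * real n) * x"
      using n x by (intro mult_right_mono mult_left_mono) auto
    also have "\<dots> = 2 * h"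
    proof -
      have "real n * x = real n powr (- (3/2 + \<epsilon>))"
        using n powr_mult_base[of "real n" "- (5/2 + \<epsilon>)"] by (simp add: x_def algebra_simps)
      then have "2 ^ n * (2 * (real n * x)) = 2 * h"
        unfolding h_def powr_minus_divide by simp
      then show ?thesis by (simp only: mult.assoc)
    qed
    \<comment> \<open>Passing from base \<open>e\<close> to base 2 costs at most a factor 2, because
      \<open>ln 2 \<ge> 1/2\<close>.\<close>
    also have "\<dots> \<le> 4 * h * ln 2"
    proof -
      have "1 / 2 \<le> ln (2 :: real)" using ln_le_minus_one[of "1/2 :: real"] by (simp add: ln_div)
      then show ?thesis using h0 mult_left_mono[of "1/2" "ln 2" "4 * h"] by simp
    qed
    finally show ?thesis by (simp add: powr_def)
  qed
  \<comment> \<open>Each flat of the cover costs \<open>(5/2 + \<epsilon>) * L\<close> bits; as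
    \<open>K\<close> already carries a logarithm, this is the source of the squared
    logarithm.\<close>
  also have "x powr (- K) = 2 powr (K * (5/2 + \<epsilon>) * L)"
    using n by (simp add: x_def L_def log_def powr_def algebra_simps)
  also have "2 powr (4 * h) * 2 powr (K * (5/2 + \<epsilon>) * L) = 2 powr (4 * h + K * (5/2 + \<epsilon>) * L)"
    by (simp add: powr_add)
  also have "\<dots> \<le> 2 powr ((4 + cover_const * (5/2 + \<epsilon>)) * (h * L\<^sup>2))"
  proof (rule powr_mono)
    have "4 * h \<le> 4 * (h * L\<^sup>2)"
      using h0 L1 mult_left_mono[of 1 "L\<^sup>2" h] by (simp add: one_le_power)
    moreover have "K * (5/2 + \<epsilon>) * L \<le> cover_const * (5/2 + \<epsilon>) * (h * L\<^sup>2)"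
    proof -
      have "K \<le> cover_const * h * L"
        unfolding K_def using cover_const_pos h0 lnL by (intro mult_left_mono) auto
      then have "K * ((5/2 + \<epsilon>) * L) \<le> cover_const * h * L * ((5/2 + \<epsilon>) * L)"
        using pos L1 by (intro mult_right_mono) auto
      then show ?thesis by (simp add: power2_eq_square algebra_simps)
    qed
    ultimately show "4 * h + K * (5/2 + \<epsilon>) * L \<le> (4 + cover_const * (5/2 + \<epsilon>)) * (h * L\<^sup>2)"
      by (simp add: algebra_simps)
  qed simp
  finally show ?thesis by (simp add: h_def L_def mult_right_mono mult_left_mono)
qed

end

theorem theorem3p11:
  fixes \<M> :: "nat matroid set" and s :: nat and c \<epsilon> :: real
  assumes "matroid_class \<M>" and "contraction_closed \<M>"
    and "s \<ge> 1" and "c > 0" and "\<epsilon> > 0"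
    and "\<And>n. \<M> \<inter> matroids_on_rank n s \<noteq> {} \<Longrightarrow>
           real (Max (cover_complexity ` (\<M> \<inter> matroids_on_rank n s)))
             \<le> c * real n powr (real s - 1 - \<epsilon>)"
  shows "(\<lambda>n. log 2 (real (card (\<M> \<inter> matroids_on n))))
           \<in> O(\<lambda>n. 1 / real n powr (3/2 + \<epsilon>) * 2 ^ n * (log 2 (real n))\<^sup>2)"
proof -
  define g where "g = (\<lambda>n. 1 / real n powr (3/2 + \<epsilon>) * 2 ^ n * (log 2 (real n))\<^sup>2)"
  define C where "C = 4 + cover_const s c * (5/2 + \<epsilon>)"
  have C1: "C \<ge> 1"
    using cover_const_pos[OF assms] \<open>\<epsilon> > 0\<close> by (simp add: C_def)
  \<comment> \<open>For middle ranks \<open>4 * r > n \<ge> 4 * s\<close>, so that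
    \<open>s \<le> r\<close>.\<close>
  have "eventually (\<lambda>n. n \<ge> 3 + 4 * s) sequentially" by (rule eventually_ge_at_top)
  moreover have "eventually (\<lambda>n. \<epsilon> \<le> real s - 1 \<longrightarrow>
      real n powr (real s - 1 - \<epsilon>) \<le> 1 / real n powr (3/2 + \<epsilon>) * 2 ^ n) sequentially"
  proof (cases "\<epsilon> \<le> real s - 1")
    case True
    have "eventually (\<lambda>n. real n powr (real s - 1 - \<epsilon>) \<le> 1 / real n powr (3/2 + \<epsilon>) * 2 ^ n) sequentially"
      by real_asymp
    then show ?thesis by (rule eventually_mono) simp
  qed simp
  moreover have "eventually (\<lambda>n. \<epsilon> > real s - 1 \<longrightarrow>
      c * (real n / 4) powr (real s - 1 - \<epsilon>) < 1) sequentially"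
  proof (cases "\<epsilon> > real s - 1")
    case True
    then have "real s - 1 - \<epsilon> < 0" by simp
    then have "eventually (\<lambda>n. c * (real n / 4) powr (real s - 1 - \<epsilon>) < 1) sequentially"
      by real_asymp
    then show ?thesis by (rule eventually_mono) simp
  qed simp
  \<comment> \<open>Takes care of the extreme ranks, since \<open>9/5 < 2\<close>.\<close>
  moreover have "eventually (\<lambda>n. (9/5) ^ n \<le> g n) sequentially"
    unfolding g_def by real_asymp
  moreover have "eventually (\<lambda>n. log 2 (real n + 1) \<le> g n) sequentially"
    unfolding g_def by real_asymp
  \<comment> \<open>The \<open>1\<close> added to \<open>C\<close> pays for the sum over
    \<open>n + 1\<close> ranks, through \<open>log 2 (n + 1) \<le> g n\<close>.\<close>
  ultimately have "eventually (\<lambda>n. norm (log 2 (real (card (\<M> \<inter> matroids_on n)))) \<le> (C + 1) * norm (g n)) sequentially"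
  proof eventually_elim
    case (elim n)
    have g0: "g n \<ge> 0" by (simp add: g_def)
    have rank: "real (card (\<M> \<inter> matroids_on_rank n r)) \<le> 2 powr (C * g n)" if "r \<le> n" for r
    proof (cases "4 * r \<le> n \<or> 3 * n \<le> 4 * r")
      case True
      have "card (\<M> \<inter> matroids_on_rank n r) \<le> card (matroids_on_rank n r)"
        by (intro card_mono finite_matroids_on_rank) auto
      also have "\<dots> \<le> 2 ^ (n choose r)" by (rule card_matroids_on_rank_le)
      finally have "real (card (\<M> \<inter> matroids_on_rank n r)) \<le> real (2 ^ (n choose r))"
        by (rule of_nat_mono)
      also have "\<dots> = 2 powr real (n choose r)" by (simp add: powr_realpow)
      also have "\<dots> \<le> 2 powr (C * g n)"
        using binomial_le_small_exp'[OF that True] elim(4) mult_right_mono[OF C1 g0]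
        by (intro powr_mono) auto
      finally show ?thesis .
    next
      case False
      then show ?thesis
        using card_middle_rank_le[OF assms, of n r] elim(1-3) that by (simp add: g_def C_def)
    qed
    have "card (\<M> \<inter> matroids_on n) \<le> (\<Sum>r\<le>n. card (\<M> \<inter> matroids_on_rank n r))"
      unfolding matroids_on_eq_Union Int_UN_distrib by (rule card_UN_le) simp
    then have "real (card (\<M> \<inter> matroids_on n)) \<le> (\<Sum>r\<le>n. real (card (\<M> \<inter> matroids_on_rank n r)))"
      by (metis of_nat_le_iff of_nat_sum)
    also have "\<dots> \<le> (real n + 1) * 2 powr (C * g n)"
      using sum_bounded_above[of "{..n}" "\<lambda>r. real (card (\<M> \<inter> matroids_on_rank n r))" "2 powr (C * g n)"]
        rank by (simp add: add.commute)
    finally have le: "real (card (\<M> \<inter> matroids_on n)) \<le> (real n + 1) * 2 powr (C * g n)" .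
    show ?case
    proof (cases "card (\<M> \<inter> matroids_on n) = 0")
      \<comment> \<open>A zero count relies on the convention that the logarithm of 0 is 0.\<close>
      case True
      then show ?thesis using C1 g0 by (simp add: log_def)
    next
      case False
      then have "0 \<le> log 2 (real (card (\<M> \<inter> matroids_on n)))" by simp
      moreover have "log 2 (real (card (\<M> \<inter> matroids_on n))) \<le> log 2 ((real n + 1) * 2 powr (C * g n))"
        using le False by (subst log_le_cancel_iff) auto
      moreover have "log 2 ((real n + 1) * 2 powr (C * g n)) = log 2 (real n + 1) + C * g n"
        by (subst log_mult) auto
      ultimately show ?thesis using elim(5) g0 by (simp add: algebra_simps)
    qed
  qed
  then have "(\<lambda>n. log 2 (real (card (\<M> \<inter> matroids_on n)))) \<in> O(g)" by (rule bigoI)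
  then show ?thesis by (simp add: g_def)
qed

end
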